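(* Let $m,n\ge 1$ be integers, let $\alpha\in(0,1/2)$, and let $\Theta=\{\theta_{i,j}: 1\le i\le m,\ 1\le j\le n\}$ be any collection of real numbers. For $\mathbf{x}=(x_1,\dots,x_m)\in\mathbb{Z}^m$ put $L_j(\mathbf{x})=\sum_{i=1}^m\theta_{i,j}x_i$, $1\le j\le n$. Then the set $\mathcal{B}(\Theta)$ of all real vectors $(\eta_1,\dots,\eta_n)\in\mathbb{R}^n$ for which $$\inf_{\mathbf{x}\in\mathbb{Z}^m\setminus\{\mathbf{0}\}}\left(\max_{1\le j\le n}\|L_j(\mathbf{x})-\eta_j\|\right)^n\left(\max_{1\le i\le m}|x_i|\right)^m>0$$ is an $\alpha$-winning set in $\mathbb{R}^n$.
   Context: $\|\cdot\|$ denotes the distance from a real number to the nearest integer. Winning sets (Schmidt's game): let $\alpha,\beta\in(0,1)$ and $E\subset\mathbb{R}^n$. Two players, Black and White, play as follows. Black chooses a closed Euclidean ball $B_0\subset\mathbb{R}^n$ of arbitrary radius $\rho>0$. Then White chooses a closed ball $W_0\subset B_0$ of radius $\alpha\rho$, Black chooses a closed ball $B_1\subset W_0$ of radius $\alpha\beta\rho$, and so on: for each $j\ge 0$, White chooses a closed ball $W_j\subset B_j$ whose radius is $\alpha$ times that of $B_j$, and Black chooses a closed ball $B_{j+1}\subset W_j$ whose radius is $\beta$ times that of $W_j$. White wins if the unique point of $\bigcap_j B_j$ belongs to $E$. The set $E$ is $(\alpha,\beta)$-winning if White has a strategy which guarantees a win however Black plays, and $E$ is $\alpha$-winning if it is $(\alpha,\beta)$-winning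 for every $\beta\in(0,1)$. *)

theory Defs
  imports "HOL-Analysis.Analysis"
begin

text \<open>
  A pair \<open>(c, r)\<close> stands for the closed ball with centre \<open>c\<close> and radius \<open>r\<close>.
  In a Euclidean space of dimension at least 1, a closed ball of positive radius
  determines its centre and radius, so moves can be recorded as such pairs.
\<close>

type_synonym 'a game_ball = "'a \<times> real"

definition ball_set :: "'a::metric_space game_ball \<Rightarrow> 'a set" where
  "ball_set b = cball (fst b) (snd b)"

definition legal_move :: "real \<Rightarrow> 'a::metric_space game_ball \<Rightarrow> 'a game_ball \<Rightarrow> bool" where
  "legal_move \<gamma> b b' \<longleftrightarrow> snd b' = \<gamma> * snd b \<and> ball_set b' \<subseteq> ball_set b"

text \<open>
  A strategy for White maps the history \<open>[B 0, \<dots>, B j]\<close> of Black's balls to White's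
  ball \<open>W j\<close>; White's own earlier balls are determined by the strategy and that history.
  The first conjunct says that White must answer legally as long as Black has played
  legally, the second that White wins every play in which Black always plays legally.
\<close>

definition winning_strategy ::
  "real \<Rightarrow> real \<Rightarrow> 'a::euclidean_space set \<Rightarrow> ('a game_ball list \<Rightarrow> 'a game_ball) \<Rightarrow> bool" where
  "winning_strategy \<alpha> \<beta> E \<sigma> \<longleftrightarrow>
     (\<forall>B :: nat \<Rightarrow> 'a game_ball. 0 < snd (B 0) \<longrightarrow>
        (let W = (\<lambda>j. \<sigma> (map B [0..<Suc j])) in
           (\<forall>j. (\<forall>i<j. legal_move \<beta> (W i) (B (Suc i))) \<longrightarrow> legal_move \<alpha> (B j) (W j)) \<and>
           ((\<forall>j. legal_move \<beta> (W j) (B (Suc j))) \<longrightarrow>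
              (\<exists>p. (\<Inter>j. ball_set (B j)) = {p} \<and> p \<in> E))))"

definition alpha_beta_winning :: "real \<Rightarrow> real \<Rightarrow> 'a::euclidean_space set \<Rightarrow> bool" where
  "alpha_beta_winning \<alpha> \<beta> E \<longleftrightarrow> (\<exists>\<sigma>. winning_strategy \<alpha> \<beta> E \<sigma>)"

definition alpha_winning :: "real \<Rightarrow> 'a::euclidean_space set \<Rightarrow> bool" where
  "alpha_winning \<alpha> E \<longleftrightarrow> (\<forall>\<beta>. 0 < \<beta> \<and> \<beta> < 1 \<longrightarrow> alpha_beta_winning \<alpha> \<beta> E)"

definition dist_int :: "real \<Rightarrow> real" where
  "dist_int t = infdist t \<int>"

text \<open>The entry \<open>\<Theta> $ i $ j\<close> is $\theta_{i,j}$.\<close>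

definition lin_form :: "real^'n^'m \<Rightarrow> 'n \<Rightarrow> int^'m \<Rightarrow> real" where
  "lin_form \<Theta> j x = (\<Sum>i\<in>UNIV. \<Theta> $ i $ j * of_int (x $ i))"

definition bad_affine :: "real^'n^'m \<Rightarrow> (real^'n) set" where
  "bad_affine \<Theta> =
     {\<eta>. (INF x \<in> UNIV - {0 :: int^'m}.
            (MAX j. dist_int (lin_form \<Theta> j x - \<eta> $ j)) ^ CARD('n) *
            (MAX i. \<bar>real_of_int (x $ i)\<bar>) ^ CARD('m)) > 0}"

end

theory Submission
  imports Defs
begin

text \<open>
  The link between the game and the affine forms is a transference argument. For an integer
  vector \<open>y\<close> let \<open>approx_error \<Theta> y\<close> be the largest distance to the nearest integer of a
  coordinate of \<open>\<Theta> *v y\<close>. If \<open>y \<bullet> \<eta>\<close> stays at distance at least \<open>\<delta>\<close> from the integers, then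
  the identity
    \<open>y \<bullet> \<eta> = (\<Sum>i. x\<^sub>i (\<Theta> *v y)\<^sub>i) - (\<Sum>j. y\<^sub>j (L\<^sub>j(x) - \<eta>\<^sub>j))\<close>
  shows that an \<open>x\<close> with \<open>\<bar>x\<bar> approx_error \<Theta> y\<close> small compared to \<open>\<delta>\<close> cannot bring all the
  \<open>L\<^sub>j(x) - \<eta>\<^sub>j\<close> within \<open>const * \<delta> / \<bar>y\<bar>\<close> of the integers. By Dirichlet's theorem a suitable
  \<open>y\<close> exists with \<open>\<bar>y\<bar>\<close> at most a constant times \<open>\<bar>x\<bar>\<close> to the power \<open>m/n\<close>, and it can be taken
  to be a best approximation. So \<open>\<eta>\<close> lies in \<open>bad_affine \<Theta>\<close> as soon as \<open>y \<bullet> \<eta>\<close> is bounded away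
  from the integers uniformly in the best approximations \<open>y\<close> (\<open>bad_affineI\<close>).
\<close>

text \<open>
  The norms of best approximations may be far from lacunary one by one, but only boundedly many
  lie in any interval \<open>(R, D R]\<close> (\<open>bounded_per_scale_best_approximations\<close>): two of them that are
  close on the scale \<open>R\<close> and whose residual vectors have the same signs would have a
  difference that is shorter than both and no worse than the worse of the two.
\<close>

text \<open>
  For every set \<open>S\<close> of vectors of norm at least 1 with this counting property White can keep all \<open>y \<bullet> \<eta>\<close>,
  \<open>y \<in> S\<close>, away from the integers (\<open>alpha_winning_of_bounded_per_scale\<close>). When \<open>\<bar>y\<bar> \<rho> \<le> 1/4\<close>
  at most one hyperplane \<open>y \<bullet> \<eta> = k\<close> matters in a ball of radius \<open>\<rho>\<close>, and since \<open>\<alpha> < 1/2\<close> a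
  single move in a direction \<open>v\<close> nearly parallel to \<open>\<plusminus>y\<close>, with the sign pointing away from that
  hyperplane, leaves a gap proportional to \<open>\<bar>y\<bar> \<rho>\<close>. One direction serves many vectors: choose it
  from a finite net of \<open>K\<close> unit vectors so as to deal with at least a fraction \<open>1/K\<close> of the total
  weight \<open>(\<bar>y\<bar> \<rho>) powr -\<tau>\<close> of the vectors still threatening the current ball. For a small \<open>\<tau>\<close> the
  growth of the weights from turn to turn is more than offset by this loss, and the boundedly
  many newcomers add a bounded amount (\<open>danger_step\<close>). Hence the total weight stays bounded, which
  means that every \<open>y\<close> is dealt with while \<open>\<bar>y\<bar> \<rho>\<close> is still bounded from below.
\<close>

section \<open>Distance to the nearest integer\<close>

lemma dist_int_le: "dist_int t \<le> \<bar>t - of_int k\<bar>"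
proof -
  have "infdist t \<int> \<le> dist t (of_int k)"
    by (rule infdist_le) simp
  then show ?thesis
    by (simp add: dist_int_def dist_real_def)
qed

lemma le_dist_intI:
  assumes "\<And>k::int. d \<le> \<bar>t - of_int k\<bar>"
  shows "d \<le> dist_int t"
proof -
  have "\<int> \<noteq> ({} :: real set)" by auto
  moreover have "d \<le> dist t a" if "a \<in> \<int>" for a
    using that assms by (auto simp: dist_real_def elim!: Ints_cases)
  ultimately show ?thesis
    unfolding dist_int_def infdist_def by (auto intro!: cINF_greatest)
qed

lemma dist_int_round: "dist_int t = \<bar>t - of_int (round t)\<bar>"
proof (rule antisym[OF dist_int_le le_dist_intI])
  fix k :: int
  show "\<bar>t - of_int (round t)\<bar> \<le> \<bar>t - of_int k\<bar>"
    using round_diff_minimal[of t k] by (simp add: abs_minus_commute)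
qed

lemma dist_int_nonneg: "0 \<le> dist_int t"
  by (simp add: dist_int_round)

lemma dist_int_int_mult: "dist_int (of_int k * t) \<le> \<bar>of_int k\<bar> * dist_int t"
proof -
  have "dist_int (of_int k * t) \<le> \<bar>of_int k * t - of_int (k * round t)\<bar>"
    by (rule dist_int_le)
  also have "\<dots> = \<bar>of_int k * (t - of_int (round t))\<bar>"
    by (simp add: algebra_simps)
  finally show ?thesis
    by (simp add: abs_mult dist_int_round)
qed

lemma dist_int_add: "dist_int (s + t) \<le> dist_int s + dist_int t"
proof -
  have "dist_int (s + t) \<le> \<bar>s + t - of_int (round s + round t)\<bar>"
    by (rule dist_int_le)
  then show ?thesis by (simp add: dist_int_round)
qed

lemma dist_int_sum: "dist_int (sum f A) \<le> (\<Sum>i\<in>A. dist_int (f i))"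
proof (induction A rule: infinite_finite_induct)
  case (insert a A)
  then show ?case using dist_int_add[of "f a" "sum f A"] by simp
qed (simp_all add: dist_int_round)

lemma dist_int_uminus: "dist_int (- t) = dist_int t"
  using dist_int_int_mult[of "-1" t] dist_int_int_mult[of "-1" "-t"] by simp

section \<open>Choosing a direction\<close>

text \<open>
  By compactness, finitely many unit vectors suffice to be almost parallel to every vector.
\<close>

lemma finite_direction_net:
  fixes c :: real
  assumes "c < 1"
  obtains V :: "'a::euclidean_space set"
  where "finite V" "V \<noteq> {}" "\<And>v. v \<in> V \<Longrightarrow> norm v = 1"
    "\<And>y. \<exists>v\<in>V. c * norm y \<le> v \<bullet> y"
proof -
  define e where "e = sqrt (2 * (1 - c))"
  have e: "e > 0" using assms by (simp add: e_def)
  have "compact (sphere (0::'a) 1)" by simp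
  then obtain V where V: "V \<subseteq> sphere 0 1" "finite V" "sphere (0::'a) 1 \<subseteq> (\<Union>x\<in>V. ball x e)"
    by (rule compactE_image[of _ "sphere 0 1" "\<lambda>x. ball x e"]) (use e in auto)
  have key: "\<exists>v\<in>V. c * norm y \<le> v \<bullet> y" if "y \<noteq> 0" for y :: 'a
  proof -
    define u where "u = y /\<^sub>R norm y"
    have u: "norm u = 1" "y = norm y *\<^sub>R u" using that by (simp_all add: u_def)
    with V obtain v where v: "v \<in> V" "dist v u < e" by force
    have "norm v = 1" using v V by auto
    then have "(dist v u)\<^sup>2 = 2 - 2 * (v \<bullet> u)"
      using u by (simp add: dist_norm power2_norm_eq_inner algebra_simps inner_commute norm_eq_1)
    moreover have "(dist v u)\<^sup>2 \<le> e\<^sup>2" using v by (intro power_mono) auto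
    moreover have "e\<^sup>2 = 2 * (1 - c)" using assms by (simp add: e_def)
    ultimately have "c \<le> v \<bullet> u" by simp
    then have "c * norm y \<le> norm y * (v \<bullet> u)"
      using mult_left_mono[of c "v \<bullet> u" "norm y"] by (simp add: mult.commute)
    also have "\<dots> = v \<bullet> y" by (subst (2) u(2)) simp
    finally show ?thesis using v by blast
  qed
  obtain b :: 'a where "b \<in> Basis" using nonempty_Basis by blast
  then have "b \<noteq> 0" by auto
  with key have ne: "V \<noteq> {}" by blast
  have all: "\<exists>v\<in>V. c * norm y \<le> v \<bullet> y" for y :: 'a
    using key[of y] ne by (cases "y = 0") auto
  show thesis
    by (rule that[OF V(2) ne _ all]) (use V(1) in auto)
qed

lemma weighted_pigeonhole:
  fixes w :: "'b \<Rightarrow> real"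
  assumes "finite A" "finite V" "V \<noteq> {}" and "\<And>y. y \<in> A \<Longrightarrow> 0 \<le> w y"
    and "\<And>y. y \<in> A \<Longrightarrow> \<exists>v\<in>V. P v y"
  shows "\<exists>v\<in>V. sum w A / card V \<le> sum w {y\<in>A. P v y}"
proof (rule ccontr)
  assume "\<not> ?thesis"
  then have "(\<Sum>v\<in>V. sum w {y\<in>A. P v y}) < (\<Sum>v\<in>V. sum w A / card V)"
    using assms by (intro sum_strict_mono) auto
  also have "\<dots> = sum w A" using assms by simp
  also have "sum w A \<le> (\<Sum>y\<in>A. \<Sum>v\<in>V. if P v y then w y else 0)"
  proof (rule sum_mono)
    fix y assume y: "y \<in> A"
    with assms obtain v where v: "v \<in> V" "P v y" by blast
    have "(if P v y then w y else 0) \<le> (\<Sum>v\<in>V. if P v y then w y else 0)"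
      using assms y v by (intro member_le_sum) auto
    with v show "w y \<le> (\<Sum>v\<in>V. if P v y then w y else 0)" by simp
  qed
  also have "\<dots> = (\<Sum>v\<in>V. \<Sum>y\<in>A. if P v y then w y else 0)" by (rule sum.swap)
  also have "\<dots> = (\<Sum>v\<in>V. sum w {y\<in>A. P v y})"
    using assms(1) by (simp add: sum.inter_filter)
  finally show False by simp
qed

text \<open>
  The effect of one move of White. The number \<open>s = \<plusminus>1\<close> says on which side of its nearest
  hyperplane \<open>y \<bullet> \<eta> = k\<close> the centre \<open>b\<close> of Black's ball lies. Moving the centre by
  \<open>(1 - \<alpha>) \<rho>\<close> in a direction with cosine at least \<open>c\<close> to \<open>s y\<close> gains \<open>(1 - \<alpha>) c \<bar>y\<bar> \<rho>\<close>, of which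
  the new ball, of radius \<open>\<alpha> \<rho>\<close>, can lose at most \<open>\<alpha> \<bar>y\<bar> \<rho>\<close>.
\<close>

lemma move_away:
  fixes y b v \<eta> :: "'a::real_inner"
  assumes "0 < \<alpha>" "\<alpha> < 1" "0 < \<rho>" "norm v = 1" "norm y * \<rho> \<le> 1/4"
    and s: "s = (if 0 \<le> y \<bullet> b - of_int (round (y \<bullet> b)) then 1 else -1)"
    and c: "c * norm y \<le> v \<bullet> (s *\<^sub>R y)"
    and \<eta>: "\<eta> \<in> cball (b + ((1 - \<alpha>) * \<rho>) *\<^sub>R v) (\<alpha> * \<rho>)"
    and g: "0 \<le> (1 - \<alpha>) * c - \<alpha>" "c \<le> 1"
  shows "((1 - \<alpha>) * c - \<alpha>) * norm y * \<rho> \<le> dist_int (y \<bullet> \<eta>)"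
proof -
  define a where "a = round (y \<bullet> b)"
  define t where "t = s * (y \<bullet> b - of_int a)"
  define z where "z = \<eta> - (b + ((1 - \<alpha>) * \<rho>) *\<^sub>R v)"
  define g where "g = ((1 - \<alpha>) * c - \<alpha>) * norm y * \<rho>"
  have t: "0 \<le> t" "t \<le> 1/2"
    using of_int_round_abs_le[of "y \<bullet> b"] by (auto simp: t_def s a_def split: if_splits)
  have z: "norm z \<le> \<alpha> * \<rho>"
    using \<eta> by (simp add: z_def dist_norm norm_minus_commute)
  have ss: "s * s = 1" "\<bar>s\<bar> = 1" by (simp_all add: s)
  have eq: "s * (y \<bullet> \<eta> - of_int a) = t + (1 - \<alpha>) * \<rho> * (v \<bullet> (s *\<^sub>R y)) + s * (y \<bullet> z)"
    by (simp add: t_def z_def algebra_simps inner_commute)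
  have yz: "\<bar>s * (y \<bullet> z)\<bar> \<le> norm y * (\<alpha> * \<rho>)"
    using Cauchy_Schwarz_ineq2[of y z] mult_left_mono[OF z, of "norm y"] ss by (simp add: abs_mult)
  have vy: "\<bar>v \<bullet> (s *\<^sub>R y)\<bar> \<le> norm y"
    using Cauchy_Schwarz_ineq2[of v "s *\<^sub>R y"] ss assms(4) by simp
  have p: "0 \<le> (1 - \<alpha>) * \<rho>" using assms by simp
  have lo: "g \<le> s * (y \<bullet> \<eta> - of_int a)"
    using mult_left_mono[OF c p] t yz unfolding eq g_def by (simp add: algebra_simps abs_le_iff)
  have "(1 - \<alpha>) * \<rho> * (v \<bullet> (s *\<^sub>R y)) \<le> (1 - \<alpha>) * \<rho> * norm y"
    using vy p by (intro mult_left_mono) auto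
  then have hi: "s * (y \<bullet> \<eta> - of_int a) \<le> 3/4"
    using t yz assms(5) unfolding eq by (simp add: algebra_simps abs_le_iff)
  have "(1 - \<alpha>) * c \<le> 1 - \<alpha>"
    using mult_left_mono[of c 1 "1 - \<alpha>"] assms(2) g(2) by simp
  then have "(1 - \<alpha>) * c - \<alpha> \<le> 1" using assms(1) by linarith
  then have "g \<le> 1 * (norm y * \<rho>)"
    unfolding g_def mult.assoc using assms by (intro mult_right_mono) auto
  then have g4: "g \<le> 1/4" using assms by simp
  have g0: "0 \<le> g" unfolding g_def using assms by (intro mult_nonneg_nonneg) auto
  \<comment> \<open>Reflected by \<open>s\<close> and shifted by \<open>a\<close>, the value \<open>y \<bullet> \<eta>\<close> lies in \<open>[g, 3/4]\<close> with \<open>g \<le> 1/4\<close>,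
    so it is at least \<open>g\<close> away from every integer.\<close>
  have "g \<le> \<bar>y \<bullet> \<eta> - of_int k\<bar>" for k
  proof -
    define T where "T = s * (y \<bullet> \<eta> - of_int a)"
    obtain l :: int where l: "s * of_int (k - a) = of_int l"
      by (cases "s = 1") (use s in \<open>auto intro: that[of "k - a"] that[of "a - k"] split: if_splits\<close>)
    have "\<bar>y \<bullet> \<eta> - of_int k\<bar> = \<bar>s * (y \<bullet> \<eta> - of_int k)\<bar>" using ss by (simp add: abs_mult)
    also have "s * (y \<bullet> \<eta> - of_int k) = T - of_int l"
      unfolding l[symmetric] T_def by (simp add: algebra_simps)
    finally have *: "\<bar>y \<bullet> \<eta> - of_int k\<bar> = \<bar>T - of_int l\<bar>" .
    show ?thesis
    proof (cases "l \<le> 0")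
      case True
      then have "real_of_int l \<le> 0" by simp
      then show ?thesis using * lo g0 unfolding T_def by linarith
    next
      case False
      then have "real_of_int l \<ge> 1" by linarith
      then show ?thesis using * hi g4 unfolding T_def by linarith
    qed
  qed
  then show ?thesis unfolding g_def by (rule le_dist_intI)
qed


section \<open>Positional strategies\<close>

text \<open>
  White's ball after moving the centre of \<open>B\<close> in the unit direction \<open>v\<close> as far as possible,
  so that the new ball touches the boundary of \<open>B\<close> from inside.
\<close>

definition white_move :: "real \<Rightarrow> 'a::real_normed_vector \<Rightarrow> 'a game_ball \<Rightarrow> 'a game_ball" where
  "white_move \<alpha> v B = (fst B + ((1 - \<alpha>) * snd B) *\<^sub>R v, \<alpha> * snd B)"

lemma legal_white_move:
  fixes v :: "'a::euclidean_space"
  assumes "0 \<le> snd B" "\<alpha> \<le> 1" "norm v = 1"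
  shows "legal_move \<alpha> B (white_move \<alpha> v B)"
proof -
  have "cball (fst B + ((1 - \<alpha>) * snd B) *\<^sub>R v) (\<alpha> * snd B) \<subseteq> cball (fst B) (snd B)"
    using assms unfolding cball_subset_cball_iff dist_norm add_diff_cancel_left'
    by (simp add: abs_mult) (simp add: algebra_simps)
  then show ?thesis by (simp add: legal_move_def white_move_def ball_set_def)
qed

lemma legal_play:
  assumes "0 < \<alpha>" "\<alpha> < 1" "0 < \<beta>" "0 < snd (B 0)" "\<And>b. norm (d b) = 1"
    and "\<And>i. i < j \<Longrightarrow> legal_move \<beta> (white_move \<alpha> (d (B i)) (B i)) (B (Suc i))"
  shows "snd (B j) = (\<alpha> * \<beta>) ^ j * snd (B 0)" and "0 < snd (B j)"
proof -
  show "snd (B j) = (\<alpha> * \<beta>) ^ j * snd (B 0)" using assms(6)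
    by (induction j) (auto simp: legal_move_def white_move_def)
  then show "0 < snd (B j)" using assms by simp
qed

text \<open>
  It suffices to prescribe White's direction as a function \<open>d\<close> of the current ball of Black and to
  check that every common point of Black's balls is in the target set.
\<close>

lemma positional_strategy_wins:
  fixes E :: "'a::euclidean_space set" and d :: "'a game_ball \<Rightarrow> 'a"
  assumes \<alpha>: "0 < \<alpha>" "\<alpha> < 1" and \<beta>: "0 < \<beta>" "\<beta> < 1" and d: "\<And>b. norm (d b) = 1"
    and win: "\<And>B p. 0 < snd (B 0) \<Longrightarrow>
      (\<And>j. legal_move \<beta> (white_move \<alpha> (d (B j)) (B j)) (B (Suc j))) \<Longrightarrow>
      (\<And>j. p \<in> ball_set (B j)) \<Longrightarrow> p \<in> E"
  shows "alpha_beta_winning \<alpha> \<beta> E"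
proof -
  define \<sigma> where "\<sigma> h = white_move \<alpha> (d (last h)) (last h)" for h
  have "(\<exists>p. (\<Inter>j. ball_set (B j)) = {p} \<and> p \<in> E)"
    if B: "0 < snd (B 0)" and L: "\<And>j. legal_move \<beta> (white_move \<alpha> (d (B j)) (B j)) (B (Suc j))"
    for B :: "nat \<Rightarrow> 'a game_ball"
  proof -
    have snd: "snd (B j) = (\<alpha> * \<beta>) ^ j * snd (B 0)" "0 < snd (B j)" for j
      using legal_play[of \<alpha> \<beta> B d j] \<alpha> \<beta> B L d by auto
    have "ball_set (B (Suc j)) \<subseteq> ball_set (B j)" for j
      using L[of j] legal_white_move[of "B j" \<alpha> "d (B j)"] snd(2)[of j] \<alpha> d
      by (auto simp: legal_move_def)
    then have "decseq (\<lambda>j. ball_set (B j))" by (rule decseq_SucI)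
    moreover have "\<exists>n. \<forall>x\<in>ball_set (B n). \<forall>y\<in>ball_set (B n). dist x y < e" if "e > 0" for e
    proof -
      have "\<alpha> * \<beta> < 1" using \<alpha> \<beta> mult_strict_mono[of \<alpha> 1 \<beta> 1] by simp
      then obtain n where n: "(\<alpha> * \<beta>) ^ n < e / (2 * snd (B 0))"
        using real_arch_pow_inv[of "e / (2 * snd (B 0))" "\<alpha> * \<beta>"] \<open>e > 0\<close> B by fastforce
      have "2 * snd (B n) < e" using n B unfolding snd(1)[of n] by (simp add: field_simps)
      moreover have "dist x y \<le> 2 * snd (B n)" if "x \<in> ball_set (B n)" "y \<in> ball_set (B n)" for x y
        using that dist_triangle3[of x y "fst (B n)"] by (simp add: ball_set_def)
      ultimately show ?thesis by (meson le_less_trans)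
    qed
    moreover have "closed (ball_set (B j))" "ball_set (B j) \<noteq> {}" for j
      using snd(2)[of j] by (auto simp: ball_set_def)
    ultimately have "\<exists>p. (\<Inter>j. ball_set (B j)) = {p}"
      by (intro decreasing_closed_nest_sing) (simp_all add: decseq_def)
    then obtain p where p: "(\<Inter>j. ball_set (B j)) = {p}" by blast
    then have "p \<in> ball_set (B j)" for j by blast
    with p win[OF B L] show ?thesis by blast
  qed
  moreover have "legal_move \<alpha> (B j) (white_move \<alpha> (d (B j)) (B j))"
    if "0 < snd (B 0)" "\<And>i. i < j \<Longrightarrow> legal_move \<beta> (white_move \<alpha> (d (B i)) (B i)) (B (Suc i))"
    for B :: "nat \<Rightarrow> 'a game_ball" and j
    using legal_play(2)[of \<alpha> \<beta> B d j] that \<alpha> \<beta> d by (intro legal_white_move) auto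
  ultimately have "winning_strategy \<alpha> \<beta> E \<sigma>"
    unfolding winning_strategy_def \<sigma>_def Let_def by simp
  then show ?thesis unfolding alpha_beta_winning_def by blast
qed

lemma alpha_winning_mono:
  fixes E F :: "'a::euclidean_space set"
  assumes "alpha_winning \<alpha> E" "E \<subseteq> F"
  shows "alpha_winning \<alpha> F"
proof -
  have "winning_strategy \<alpha> \<beta> F \<sigma>" if "winning_strategy \<alpha> \<beta> E \<sigma>" for \<beta> \<sigma>
    unfolding winning_strategy_def Let_def
  proof (intro allI impI conjI)
    fix B :: "nat \<Rightarrow> 'a game_ball" assume "0 < snd (B 0)"
    note B = spec[OF that[unfolded winning_strategy_def Let_def], of B, THEN mp, OF this]
    show "legal_move \<alpha> (B j) (\<sigma> (map B [0..<Suc j]))"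
      if "\<forall>i<j. legal_move \<beta> (\<sigma> (map B [0..<Suc i])) (B (Suc i))" for j
      by (rule conjunct1[OF B, rule_format]) (use that in simp)
    assume "\<forall>j. legal_move \<beta> (\<sigma> (map B [0..<Suc j])) (B (Suc j))"
    then have "\<exists>p. (\<Inter>j. ball_set (B j)) = {p} \<and> p \<in> E"
      by (intro conjunct2[OF B, rule_format]) simp
    with assms(2) show "\<exists>p. (\<Inter>j. ball_set (B j)) = {p} \<and> p \<in> F" by auto
  qed
  then show ?thesis
    using assms(1) unfolding alpha_winning_def alpha_beta_winning_def by blast
qed

section \<open>Avoiding the hyperplanes of a set with boundedly many vectors per scale\<close>

text \<open>
  For each ratio \<open>D\<close>, the number of elements of \<open>S\<close> with norm in \<open>(R, D R]\<close> is bounded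
  independently of \<open>R > 0\<close>. This is a weak form of lacunarity.
\<close>

definition bounded_per_scale :: "'a::real_normed_vector set \<Rightarrow> bool" where
  "bounded_per_scale S \<longleftrightarrow> (\<forall>D. \<exists>N. \<forall>R>0.
     finite {y\<in>S. R < norm y \<and> norm y \<le> D * R} \<and> card {y\<in>S. R < norm y \<and> norm y \<le> D * R} \<le> N)"

text \<open>
  The vectors that White still has to deal with when Black has played \<open>B\<close>, of radius \<open>\<rho>\<close>: those
  which are short enough for at most one hyperplane \<open>y \<bullet> \<eta> = k\<close> to matter in \<open>B\<close> and for which
  \<open>B\<close> still has points with \<open>y \<bullet> \<eta>\<close> closer than \<open>\<gamma> \<bar>y\<bar> \<rho>\<close> to an integer. The latter condition
  becomes stronger when \<open>B\<close> is replaced by a smaller ball inside it, so a short enough vector that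
  does not threaten \<open>B\<close> will not threaten any later ball. The definition depends on the current ball only, which makes White's strategy positional.
\<close>

definition threats :: "'a::euclidean_space set \<Rightarrow> real \<Rightarrow> 'a game_ball \<Rightarrow> 'a set" where
  "threats S \<gamma> B = {y\<in>S. norm y * snd B \<le> 1/4 \<and>
     (\<exists>\<eta>\<in>ball_set B. dist_int (y \<bullet> \<eta>) < \<gamma> * norm y * snd B)}"

text \<open>
  The potential function of the strategy: a threatening vector counts the more the longer it has
  been left alone, since \<open>norm y * snd B\<close> shrinks by the factor \<open>\<alpha> * \<beta>\<close> each turn.
\<close>

definition danger :: "'a::euclidean_space set \<Rightarrow> real \<Rightarrow> real \<Rightarrow> 'a game_ball \<Rightarrow> real" where
  "danger S \<gamma> \<tau> B = (\<Sum>y\<in>threats S \<gamma> B. (norm y * snd B) powr (- \<tau>))"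

lemma finite_threats:
  assumes "bounded_per_scale S" "\<And>y. y \<in> S \<Longrightarrow> 1 \<le> norm y" "0 < snd B"
  shows "finite (threats S \<gamma> B)"
proof (rule finite_subset)
  show "threats S \<gamma> B \<subseteq> {y\<in>S. 1/2 < norm y \<and> norm y \<le> (1 / (2 * snd B)) * (1/2)}"
    using assms(3) by (auto simp: threats_def field_simps dest: assms(2))
  show "finite {y\<in>S. 1/2 < norm y \<and> norm y \<le> (1 / (2 * snd B)) * (1/2)}"
    using assms(1) half_gt_zero[OF zero_less_one] unfolding bounded_per_scale_def by blast
qed

text \<open>
  One round of the game. White's best direction from the net \<open>V\<close> removes a fraction \<open>1 / card V\<close> of
  the danger, the remaining weights are multiplied by \<open>(\<alpha> * \<beta>) powr -\<tau>\<close>, and at most \<open>N\<close> vectors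
  enter, each with weight at most \<open>(\<alpha> * \<beta> / 4) powr -\<tau>\<close>.
\<close>

lemma danger_step:
  fixes S V :: "'a::euclidean_space set" and B :: "'a game_ball"
  assumes \<alpha>: "0 < \<alpha>" "\<alpha> < 1" and \<beta>: "0 < \<beta>" "\<beta> < 1" and B: "0 < snd B"
    and S: "bounded_per_scale S" "\<And>y. y \<in> S \<Longrightarrow> 1 \<le> norm y"
    and V: "finite V" "V \<noteq> {}" "\<And>v. v \<in> V \<Longrightarrow> norm v = 1" "\<And>y. \<exists>v\<in>V. c * norm y \<le> v \<bullet> y"
    and c: "c \<le> 1" "\<gamma> = (1 - \<alpha>) * c - \<alpha>" "0 < \<gamma>"
    and \<tau>: "0 < \<tau>"
    and N: "\<And>R. R > 0 \<Longrightarrow> card {y\<in>S. R < norm y \<and> norm y \<le> (1 / (\<alpha> * \<beta>)) * R} \<le> N"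
  shows "\<exists>v\<in>V. \<forall>B'. legal_move \<beta> (white_move \<alpha> v B) B' \<longrightarrow>
    danger S \<gamma> \<tau> B' \<le> (\<alpha> * \<beta>) powr (-\<tau>) * (1 - 1 / card V) * danger S \<gamma> \<tau> B
       + N * (\<alpha> * \<beta> / 4) powr (-\<tau>)"
proof -
  define s where "s y = (if 0 \<le> y \<bullet> fst B - of_int (round (y \<bullet> fst B)) then 1 else - 1 :: real)" for y
  define P where "P v y \<longleftrightarrow> c * norm y \<le> v \<bullet> (s y *\<^sub>R y)" for v y
  define w where "w r y = (norm y * r) powr (-\<tau>)" for r and y :: 'a
  define A where "A = threats S \<gamma> B"
  have finA: "finite A" unfolding A_def by (rule finite_threats) (use S B in auto)
  have "\<exists>v\<in>V. P v y" for y
    using V(4)[of "s y *\<^sub>R y"] by (auto simp: P_def s_def)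
  then obtain v where v: "v \<in> V" "sum (w (snd B)) A / card V \<le> sum (w (snd B)) {y\<in>A. P v y}"
    using weighted_pigeonhole[OF finA V(1,2), of "w (snd B)" P] by (auto simp: w_def)
  show ?thesis
  proof (intro bexI[of _ v] allI impI)
    fix B' assume L: "legal_move \<beta> (white_move \<alpha> v B) B'"
    define W where "W = cball (fst B + ((1 - \<alpha>) * snd B) *\<^sub>R v) (\<alpha> * snd B)"
    have sB': "snd B' = \<alpha> * \<beta> * snd B" and sub: "ball_set B' \<subseteq> W"
      using L by (auto simp: legal_move_def white_move_def ball_set_def W_def)
    have sub2: "ball_set B' \<subseteq> ball_set B"
      using L legal_white_move[of B \<alpha> v] V(3) v(1) B \<alpha> by (auto simp: legal_move_def)
    have ab: "0 < \<alpha> * \<beta>" "\<alpha> * \<beta> < 1" using \<alpha> \<beta> mult_strict_mono[of \<alpha> 1 \<beta> 1] by auto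
    have le: "snd B' \<le> snd B" using ab B unfolding sB' by simp
    \<comment> \<open>the vectors that become short enough for the new radius but were not for the old one\<close>
    define new where "new = {y\<in>S. 1 / (4 * snd B) < norm y \<and> norm y \<le> (1 / (\<alpha> * \<beta>)) * (1 / (4 * snd B))}"
    have new: "finite new" "card new \<le> N"
    proof -
      have pos: "1 / (4 * snd B) > 0" using B by simp
      show "finite new" using S(1) pos unfolding bounded_per_scale_def new_def by blast
      show "card new \<le> N" unfolding new_def by (rule N[OF pos])
    qed
    have sub3: "threats S \<gamma> B' \<subseteq> (A - {y\<in>A. P v y}) \<union> new"
    proof
      fix y assume y: "y \<in> threats S \<gamma> B'"
      then obtain \<eta> where \<eta>: "\<eta> \<in> ball_set B'" "dist_int (y \<bullet> \<eta>) < \<gamma> * norm y * snd B'"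
        and yS: "y \<in> S" "norm y * snd B' \<le> 1/4" by (auto simp: threats_def)
      have "\<gamma> * norm y * snd B' \<le> \<gamma> * norm y * snd B"
        using le c(3) by (intro mult_left_mono) auto
      with \<eta> have lt: "dist_int (y \<bullet> \<eta>) < \<gamma> * norm y * snd B" by linarith
      show "y \<in> (A - {y\<in>A. P v y}) \<union> new"
      proof (cases "norm y * snd B \<le> 1/4")
        case True
        with lt \<eta>(1) sub2 yS have "y \<in> A" by (auto simp: A_def threats_def)
        moreover have "\<not> P v y"
        proof
          assume "P v y"
          then have "\<gamma> * norm y * snd B \<le> dist_int (y \<bullet> \<eta>)"
            unfolding c(2) P_def
            by (intro move_away[where s = "s y" and v = v and b = "fst B"])
               (use True \<eta>(1) sub V(3) v(1) B \<alpha> c in \<open>auto simp: s_def W_def\<close>)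
          with lt show False by simp
        qed
        ultimately show ?thesis by blast
      next
        case False
        then show ?thesis using yS B ab \<alpha> \<beta>
          by (simp add: new_def sB' field_simps)
      qed
    qed
    have wB': "w (snd B') y = (\<alpha> * \<beta>) powr (-\<tau>) * w (snd B) y" for y
    proof -
      have "norm y * snd B' = (\<alpha> * \<beta>) * (norm y * snd B)" by (simp add: sB')
      then show ?thesis unfolding w_def by (simp only: powr_mult)
    qed
    have "danger S \<gamma> \<tau> B' \<le> sum (w (snd B')) ((A - {y\<in>A. P v y}) \<union> new)"
      unfolding danger_def w_def[symmetric]
      by (rule sum_mono2) (use sub3 finA new in \<open>auto simp: w_def\<close>)
    also have "\<dots> \<le> sum (w (snd B')) (A - {y\<in>A. P v y}) + sum (w (snd B')) new"
      using finA new sum.union_inter[of "A - {y\<in>A. P v y}" new "w (snd B')"]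
        sum_nonneg[of "(A - {y\<in>A. P v y}) \<inter> new" "w (snd B')"] by (simp add: w_def)
    also have "sum (w (snd B')) (A - {y\<in>A. P v y})
        = (\<alpha> * \<beta>) powr (-\<tau>) * (sum (w (snd B)) A - sum (w (snd B)) {y\<in>A. P v y})"
      unfolding wB' sum_distrib_left[symmetric] using finA by (subst sum_diff) auto
    also have "\<dots> \<le> (\<alpha> * \<beta>) powr (-\<tau>) * (sum (w (snd B)) A - sum (w (snd B)) A / card V)"
      using v(2) by (intro mult_left_mono) auto
    also have "\<dots> = (\<alpha> * \<beta>) powr (-\<tau>) * (1 - 1 / card V) * danger S \<gamma> \<tau> B"
      by (simp add: danger_def A_def w_def algebra_simps)
    also have "sum (w (snd B')) new \<le> (\<Sum>y\<in>new. (\<alpha> * \<beta> / 4) powr (-\<tau>))"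
    proof (rule sum_mono)
      fix y assume "y \<in> new"
      then have "\<alpha> * \<beta> / 4 \<le> norm y * snd B'"
        using B ab mult_strict_left_mono[of "1/4" "norm y * snd B" "\<alpha> * \<beta>"]
        by (simp add: new_def sB' field_simps)
      then show "w (snd B') y \<le> (\<alpha> * \<beta> / 4) powr (-\<tau>)"
        unfolding w_def using ab \<tau> by (intro powr_mono2') auto
    qed
    also have "\<dots> \<le> N * (\<alpha> * \<beta> / 4) powr (-\<tau>)"
      using new(2) by (simp add: mult_right_mono)
    finally show "danger S \<gamma> \<tau> B' \<le> (\<alpha> * \<beta>) powr (-\<tau>) * (1 - 1 / card V) * danger S \<gamma> \<tau> B
       + N * (\<alpha> * \<beta> / 4) powr (-\<tau>)" by simp
  qed (use v in simp)
qed


theorem alpha_winning_of_bounded_per_scale: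
  fixes S :: "'a::euclidean_space set"
  assumes \<alpha>: "0 < \<alpha>" "\<alpha> < 1/2"
    and S: "bounded_per_scale S" "\<And>y. y \<in> S \<Longrightarrow> 1 \<le> norm y"
  shows "alpha_winning \<alpha> {\<eta>. \<exists>\<delta>>0. \<forall>y\<in>S. \<delta> \<le> dist_int (y \<bullet> \<eta>)}"
  unfolding alpha_winning_def
proof (intro allI impI)
  fix \<beta> :: real assume "0 < \<beta> \<and> \<beta> < 1"
  then have \<beta>: "0 < \<beta>" "\<beta> < 1" by auto
  have ab: "0 < \<alpha> * \<beta>" "\<alpha> * \<beta> < 1" using \<alpha> \<beta> mult_strict_mono[of \<alpha> 1 \<beta> 1] by auto
  \<comment> \<open>This is where \<open>\<alpha> < 1/2\<close> enters: a cosine \<open>c < 1\<close> can be chosen for which a move gains ground.\<close>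
  have "\<alpha> / (1 - \<alpha>) < 1" using \<alpha> by simp
  then obtain c where c: "\<alpha> / (1 - \<alpha>) < c" "c < 1" using dense by blast
  define \<gamma> where "\<gamma> = (1 - \<alpha>) * c - \<alpha>"
  have \<gamma>: "0 < \<gamma>" using c(1) \<alpha> by (simp add: \<gamma>_def field_simps)
  obtain V :: "'a set" where V: "finite V" "V \<noteq> {}" "\<And>v. v \<in> V \<Longrightarrow> norm v = 1"
    "\<And>y. \<exists>v\<in>V. c * norm y \<le> v \<bullet> y"
    using finite_direction_net[OF c(2)] by metis
  define K where "K = real (card V)"
  have K: "K \<ge> 1" using V card_gt_0_iff[of V] by (simp add: K_def Suc_le_eq)
  \<comment> \<open>With this exponent the weights grow by the factor \<open>1 + 1/K\<close> per turn while a fraction \<open>1/K\<close>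
    of them is removed, so the danger is multiplied by \<open>q = 1 - 1/K\<^sup>2 < 1\<close>.\<close>
  define \<tau> where "\<tau> = - log (\<alpha> * \<beta>) (1 + 1 / K)"
  have ln: "ln (\<alpha> * \<beta>) < 0" using ab by simp
  have "ln (1 + 1 / K) > 0" using K by (intro ln_gt_zero) simp
  then have \<tau>: "0 < \<tau>" using ln by (simp add: \<tau>_def log_def divide_neg_neg divide_less_0_iff)
  have \<lambda>: "(\<alpha> * \<beta>) powr (- \<tau>) = 1 + 1 / K"
    unfolding \<tau>_def using ab K by (simp add: powr_log_cancel add_pos_pos)
  define q where "q = (1 + 1 / K) * (1 - 1 / K)"
  have "q = 1 - (1 / K)\<^sup>2" by (simp add: q_def power2_eq_square algebra_simps)
  moreover have "0 < (1 / K)\<^sup>2" "(1 / K)\<^sup>2 \<le> 1" using K by (auto intro: power_le_one)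
  ultimately have q: "0 \<le> q" "q < 1" by auto
  obtain N where N: "\<And>R. R > 0 \<Longrightarrow> card {y\<in>S. R < norm y \<and> norm y \<le> (1 / (\<alpha> * \<beta>)) * R} \<le> N"
    using S(1) unfolding bounded_per_scale_def by meson
  define C where "C = N * (\<alpha> * \<beta> / 4) powr (-\<tau>)"
  have "\<exists>v. norm v = 1 \<and> (0 < snd B \<longrightarrow> (\<forall>B'. legal_move \<beta> (white_move \<alpha> v B) B' \<longrightarrow>
      danger S \<gamma> \<tau> B' \<le> q * danger S \<gamma> \<tau> B + C))" for B :: "'a game_ball"
  proof (cases "0 < snd B")
    case True
    have "\<exists>v\<in>V. \<forall>B'. legal_move \<beta> (white_move \<alpha> v B) B' \<longrightarrow>
      danger S \<gamma> \<tau> B' \<le> (\<alpha> * \<beta>) powr (-\<tau>) * (1 - 1 / card V) * danger S \<gamma> \<tau> B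
       + N * (\<alpha> * \<beta> / 4) powr (-\<tau>)"
      by (rule danger_step[where c = c]) (use \<alpha> \<beta> True S V c \<gamma> \<gamma>_def \<tau> N in auto)
    then show ?thesis using V(3) unfolding \<lambda> K_def[symmetric] q_def[symmetric] C_def[symmetric] by blast
  next
    case False
    then show ?thesis using V by blast
  qed
  then obtain d where d: "\<And>B. norm (d B) = 1"
    "\<And>B B'. 0 < snd B \<Longrightarrow> legal_move \<beta> (white_move \<alpha> (d B) B) B' \<Longrightarrow>
      danger S \<gamma> \<tau> B' \<le> q * danger S \<gamma> \<tau> B + C"
    by metis
  show "alpha_beta_winning \<alpha> \<beta> {\<eta>. \<exists>\<delta>>0. \<forall>y\<in>S. \<delta> \<le> dist_int (y \<bullet> \<eta>)}"
  proof (rule positional_strategy_wins[where d = d])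
    fix B :: "nat \<Rightarrow> 'a game_ball" and p
    assume B: "0 < snd (B 0)" and L: "\<And>j. legal_move \<beta> (white_move \<alpha> (d (B j)) (B j)) (B (Suc j))"
      and p: "\<And>j. p \<in> ball_set (B j)"
    have snd: "snd (B j) = (\<alpha> * \<beta>) ^ j * snd (B 0)" "0 < snd (B j)" for j
      using legal_play[of \<alpha> \<beta> B d j] \<alpha> \<beta> B L d by auto
    define M where "M = max 1 (max (danger S \<gamma> \<tau> (B 0)) (C / (1 - q)))"
    have M: "danger S \<gamma> \<tau> (B j) \<le> M" for j
    proof (induction j)
      case (Suc j)
      have "C / (1 - q) \<le> M" by (simp add: M_def)
      then have "C \<le> (1 - q) * M" using q by (simp add: pos_divide_le_eq mult.commute)
      moreover have "q * danger S \<gamma> \<tau> (B j) \<le> q * M" using Suc q by (intro mult_left_mono)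
      ultimately show ?case using d(2)[OF snd(2) L, of j] by (simp add: algebra_simps)
    qed (simp add: M_def)
    define \<mu> where "\<mu> = min (1/4) (M powr (- 1 / \<tau>))"
    have "M > 0" by (simp add: M_def)
    then have \<mu>: "0 < \<mu>" by (simp add: \<mu>_def)
    \<comment> \<open>A vector with \<open>\<bar>y\<bar> \<rho> < \<mu>\<close> would by itself have a weight above the bound \<open>M\<close>, so it is
      no longer a threat.\<close>
    have safe: "\<gamma> * (norm y * snd (B j)) \<le> dist_int (y \<bullet> p)"
      if y: "y \<in> S" "norm y * snd (B j) < \<mu>" for y j
    proof -
      have pos: "0 < norm y * snd (B j)" using S(2)[OF y(1)] snd(2)[of j] by (intro mult_pos_pos) auto
      have "y \<notin> threats S \<gamma> (B j)"
      proof
        assume "y \<in> threats S \<gamma> (B j)"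
        then have "(norm y * snd (B j)) powr (-\<tau>) \<le> danger S \<gamma> \<tau> (B j)"
          unfolding danger_def using finite_threats[OF S snd(2)] by (intro member_le_sum) auto
        then have "(norm y * snd (B j)) powr (-\<tau>) \<le> M" using M[of j] by simp
        then have "M powr (- 1 / \<tau>) \<le> ((norm y * snd (B j)) powr (-\<tau>)) powr (- 1 / \<tau>)"
          using \<tau> pos by (intro powr_mono2') auto
        also have "\<dots> = norm y * snd (B j)" using \<tau> pos by (simp add: powr_powr)
        finally show False using y by (simp add: \<mu>_def)
      qed
      then show ?thesis using y p[of j] by (force simp: threats_def \<mu>_def mult.assoc)
    qed
    define \<delta> where "\<delta> = \<gamma> * min (snd (B 0)) (\<alpha> * \<beta> * \<mu>)"
    have "\<delta> > 0" using \<gamma> B ab \<mu> by (simp add: \<delta>_def)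
    moreover have "\<delta> \<le> dist_int (y \<bullet> p)" if y: "y \<in> S" for y
    proof -
      have ny: "norm y \<ge> 1" using S y by auto
      have pos: "0 < norm y * snd (B 0)" using ny B by (intro mult_pos_pos) auto
      obtain n where "(\<alpha> * \<beta>) ^ n < \<mu> / (norm y * snd (B 0))"
        using \<mu> pos ab real_arch_pow_inv[of "\<mu> / (norm y * snd (B 0))" "\<alpha> * \<beta>"] by fastforce
      then have "(\<alpha> * \<beta>) ^ n * (norm y * snd (B 0)) < \<mu>"
        using pos by (simp only: pos_less_divide_eq)
      then have ex: "\<exists>n. norm y * snd (B n) < \<mu>"
        by (intro exI[of _ n]) (simp add: snd(1)[of n] mult_ac)
      \<comment> \<open>At the first turn with \<open>\<bar>y\<bar> \<rho> < \<mu>\<close> the quantity \<open>\<bar>y\<bar> \<rho>\<close> is not much smaller than \<open>\<mu>\<close>,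
        unless this is the opening turn.\<close>
      define n where "n = (LEAST n. norm y * snd (B n) < \<mu>)"
      have n: "norm y * snd (B n) < \<mu>" unfolding n_def by (rule LeastI_ex[OF ex])
      have "min (snd (B 0)) (\<alpha> * \<beta> * \<mu>) \<le> norm y * snd (B n)"
      proof (cases n)
        case 0
        then show ?thesis using mult_right_mono[OF ny, of "snd (B 0)"] B by (simp add: min.coboundedI1)
      next
        case (Suc k)
        then have "\<mu> \<le> norm y * snd (B k)"
          using not_less_Least[of k "\<lambda>n. norm y * snd (B n) < \<mu>"] by (simp add: n_def)
        then have "\<alpha> * \<beta> * \<mu> \<le> (\<alpha> * \<beta>) * (norm y * snd (B k))"
          using ab by (intro mult_left_mono) auto
        also have "\<dots> = norm y * snd (B n)" by (simp add: Suc snd(1)[of "Suc k"] snd(1)[of k])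
        finally show ?thesis by simp
      qed
      then have "\<delta> \<le> \<gamma> * (norm y * snd (B n))" unfolding \<delta>_def using \<gamma> by (intro mult_left_mono) auto
      with safe[OF y n] show ?thesis by simp
    qed
    ultimately show "p \<in> {\<eta>. \<exists>\<delta>>0. \<forall>y\<in>S. \<delta> \<le> dist_int (y \<bullet> \<eta>)}" by blast
  qed (use \<alpha> \<beta> d in auto)
qed


section \<open>Best approximations\<close>

text \<open>
  The lattice of integer points, as real vectors.
\<close>

definition integer_vectors :: "(real^'n) set" where
  "integer_vectors = {y. \<forall>j. y $ j \<in> \<int>}"

text \<open>
  How well \<open>y\<close> makes all coordinates of \<open>\<Theta> *v y\<close> close to integers. These are the linear forms
  transposed to those of \<open>lin_form\<close>.
\<close>

definition approx_error :: "real^'n^'m \<Rightarrow> real^'n \<Rightarrow> real" where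
  "approx_error \<Theta> y = (MAX i. dist_int ((\<Theta> *v y) $ i))"

text \<open>
  The nonzero integer vectors with smaller error than every strictly shorter one. Several vectors of
  the same length are all kept, in particular both \<open>y\<close> and \<open>- y\<close>.
\<close>

definition best_approximations :: "real^'n^'m \<Rightarrow> (real^'n) set" where
  "best_approximations \<Theta> = {y \<in> integer_vectors - {0}.
     \<forall>z \<in> integer_vectors - {0}. norm z < norm y \<longrightarrow> approx_error \<Theta> y < approx_error \<Theta> z}"

lemma dist_int_le_approx_error: "dist_int ((\<Theta> *v y) $ i) \<le> approx_error \<Theta> y"
  unfolding approx_error_def by (rule Max_ge) auto

lemma approx_error_le_iff: "approx_error \<Theta> y \<le> e \<longleftrightarrow> (\<forall>i. dist_int ((\<Theta> *v y) $ i) \<le> e)"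
  unfolding approx_error_def by (subst Max_le_iff) auto

lemma norm_integer_vector_ge_1:
  assumes "y \<in> integer_vectors" "y \<noteq> 0"
  shows "1 \<le> norm y"
proof -
  obtain j where "y $ j \<noteq> 0" using assms(2) by (auto simp: vec_eq_iff)
  then have "1 \<le> \<bar>y $ j\<bar>" using assms(1) by (intro Ints_nonzero_abs_ge1) (auto simp: integer_vectors_def)
  then show ?thesis using component_le_norm_cart[of y j] by linarith
qed

text \<open>
  Among the vectors that approximate at least as well as \<open>y\<close>, a shortest one is a best approximation.
\<close>

lemma best_approximation_exists:
  fixes y :: "real^'n"
  assumes "y \<in> integer_vectors" "y \<noteq> 0"
  shows "\<exists>z\<in>best_approximations \<Theta>. norm z \<le> norm y \<and> approx_error \<Theta> z \<le> approx_error \<Theta> y"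
proof -
  define P where "P z \<longleftrightarrow> z \<in> integer_vectors \<and> z \<noteq> 0 \<and> approx_error \<Theta> z \<le> approx_error \<Theta> y" for z
  \<comment> \<open>On integer vectors the squared norm is a natural number, so a shortest vector exists.\<close>
  define h where "h z = nat \<lfloor>(norm z)\<^sup>2\<rfloor>" for z :: "real^'n"
  have h: "real (h z) = (norm z)\<^sup>2" if "z \<in> integer_vectors" for z
  proof -
    have "(norm z)\<^sup>2 = (\<Sum>j\<in>UNIV. z $ j * z $ j)"
      by (simp add: power2_norm_eq_inner inner_vec_def)
    also have "\<dots> \<in> \<int>" using that by (auto simp: integer_vectors_def intro!: Ints_sum Ints_mult)
    finally show ?thesis unfolding h_def by (elim Ints_cases) (metis floor_of_int of_nat_nat of_int_of_nat_eq of_int_0_le_iff zero_le_power2)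
  qed
  have "P y" using assms by (simp add: P_def)
  then obtain z where z: "P z" "\<And>x. P x \<Longrightarrow> h z \<le> h x"
    using ex_has_least_nat[of P y h] by blast
  have min: "norm z \<le> norm x" if "P x" for x
  proof -
    have "(norm z)\<^sup>2 = real (h z)" using z(1) h by (simp add: P_def)
    also have "\<dots> \<le> real (h x)" using z(2)[OF that] by simp
    also have "\<dots> = (norm x)\<^sup>2" using that h by (simp add: P_def)
    finally show ?thesis by simp
  qed
  have "approx_error \<Theta> z < approx_error \<Theta> x"
    if "x \<in> integer_vectors - {0}" "norm x < norm z" for x
    using min[of x] that z(1) by (force simp: P_def)
  then have "z \<in> best_approximations \<Theta>" using z(1) by (auto simp: best_approximations_def P_def)
  then show ?thesis using min[OF \<open>P y\<close>] z(1) by (auto simp: P_def)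
qed

text \<open>
  Pigeonhole principle: a best approximation \<open>y\<close> with \<open>R < norm y \<le> D * R\<close> is determined by the
  signs of its residuals \<open>r y i\<close> and by a ball of radius \<open>R / 2\<close> that contains it, taken from a
  finite cover of the ball of radius \<open>D * R\<close>.
\<close>

lemma bounded_per_scale_best_approximations:
  fixes \<Theta> :: "real^'n^'m"
  shows "bounded_per_scale (best_approximations \<Theta>)"
  unfolding bounded_per_scale_def
proof
  fix D :: real
  have "compact (cball (0 :: real^'n) D)" by simp
  then obtain F where F: "F \<subseteq> cball 0 D" "finite F" "cball (0 :: real^'n) D \<subseteq> (\<Union>x\<in>F. ball x (1/2))"
    by (rule compactE_image[of _ "cball 0 D" "\<lambda>x. ball x (1/2)"]) auto
  define r where "r y i = (\<Theta> *v y) $ i - of_int (round ((\<Theta> *v y) $ i))" for y i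
  define N where "N = card ((UNIV :: 'm set set) \<times> F)"
  have "finite X \<and> card X \<le> N"
    if R: "R > 0" and X: "X = {y \<in> best_approximations \<Theta>. R < norm y \<and> norm y \<le> D * R}" for R X
  proof -
    have "\<exists>c\<in>F. dist c (y /\<^sub>R R) < 1/2" if "y \<in> X" for y
    proof -
      have "y /\<^sub>R R \<in> cball 0 D" using that R by (simp add: X divide_simps mult.commute)
      with F(3) obtain x where "x \<in> F" "y /\<^sub>R R \<in> ball x (1/2)" by blast
      then show ?thesis by auto
    qed
    then obtain c where c: "\<And>y. y \<in> X \<Longrightarrow> c y \<in> F" "\<And>y. y \<in> X \<Longrightarrow> dist (c y) (y /\<^sub>R R) < 1/2"
      by metis
    define f where "f y = ({i. 0 \<le> r y i}, c y)" for y
    have "inj_on f X"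
    proof (rule inj_onI, rule ccontr)
      fix y z assume yz: "y \<in> X" "z \<in> X" "f y = f z" "y \<noteq> z"
      have "dist (y /\<^sub>R R) (z /\<^sub>R R) < 1"
        using c(2)[OF yz(1)] c(2)[OF yz(2)] yz(3) dist_triangle3[of "y /\<^sub>R R" "z /\<^sub>R R" "c y"]
        by (simp add: f_def)
      then have "norm ((y - z) /\<^sub>R R) < 1" by (simp only: dist_norm scaleR_right_diff_distrib)
      then have "norm (y - z) < R"
        using R by (simp only: norm_scaleR) (simp add: field_simps)
      then have less: "norm (y - z) < norm y" "norm (y - z) < norm z" using yz by (auto simp: X)
      have d: "y - z \<in> integer_vectors - {0}"
        using yz by (auto simp: X best_approximations_def integer_vectors_def)
      have "dist_int ((\<Theta> *v (y - z)) $ i) \<le> max (approx_error \<Theta> y) (approx_error \<Theta> z)" for i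
      proof -
        have "dist_int ((\<Theta> *v (y - z)) $ i) \<le> \<bar>(\<Theta> *v (y - z)) $ i
            - of_int (round ((\<Theta> *v y) $ i) - round ((\<Theta> *v z) $ i))\<bar>" by (rule dist_int_le)
        also have "\<dots> = \<bar>r y i - r z i\<bar>"
          by (simp add: r_def matrix_vector_mult_diff_distrib algebra_simps)
        \<comment> \<open>the two residuals have the same sign\<close>
        also have "\<dots> \<le> max \<bar>r y i\<bar> \<bar>r z i\<bar>"
        proof -
          have "0 \<le> r y i \<longleftrightarrow> 0 \<le> r z i" using yz(3) by (auto simp: f_def set_eq_iff)
          then show ?thesis by linarith
        qed
        also have "\<dots> \<le> max (approx_error \<Theta> y) (approx_error \<Theta> z)"
          unfolding r_def dist_int_round[symmetric] by (intro max.mono dist_int_le_approx_error)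
        finally show ?thesis .
      qed
      then have "approx_error \<Theta> (y - z) \<le> max (approx_error \<Theta> y) (approx_error \<Theta> z)"
        by (simp add: approx_error_le_iff)
      moreover have "approx_error \<Theta> y < approx_error \<Theta> (y - z)" "approx_error \<Theta> z < approx_error \<Theta> (y - z)"
        using less d yz by (auto simp: X best_approximations_def)
      ultimately show False by simp
    qed
    moreover have "f ` X \<subseteq> UNIV \<times> F" using c(1) by (auto simp: f_def)
    moreover have "finite ((UNIV :: 'm set set) \<times> F)" using F by simp
    ultimately show ?thesis
      unfolding N_def by (meson card_inj_on_le finite_imageD finite_subset)
  qed
  then show "\<exists>N. \<forall>R>0. finite {y \<in> best_approximations \<Theta>. R < norm y \<and> norm y \<le> D * R} \<and>
      card {y \<in> best_approximations \<Theta>. R < norm y \<and> norm y \<le> D * R} \<le> N" by blast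
qed

section \<open>Transference\<close>

text \<open>
  Dirichlet's theorem for simultaneously small linear forms. Prescribing the quality \<open>1 / p\<close> and
  taking \<open>Q\<close> least with \<open>p ^ m < (Q + 1) ^ n\<close> avoids fractional exponents.
\<close>

lemma dirichlet_linear_forms:
  fixes \<Theta> :: "real^'n^'m" and p :: nat
  assumes "p \<ge> 1"
  shows "\<exists>y\<in>integer_vectors. \<exists>Q::nat. y \<noteq> 0 \<and> Q ^ CARD('n) \<le> p ^ CARD('m) \<and>
    (\<forall>j. \<bar>y $ j\<bar> \<le> real Q) \<and> approx_error \<Theta> y \<le> 1 / real p"
proof -
  define Q where "Q = (LEAST Q. p ^ CARD('m) < (Q + 1) ^ CARD('n))"
  have "p ^ CARD('m) + 1 \<le> (p ^ CARD('m) + 1) ^ CARD('n)" by (rule self_le_power) auto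
  then have "\<exists>Q. p ^ CARD('m) < (Q + 1) ^ CARD('n)"
    by (intro exI[of _ "p ^ CARD('m)"]) linarith
  then have Q: "p ^ CARD('m) < (Q + 1) ^ CARD('n)" unfolding Q_def by (rule LeastI_ex)
  have Q': "Q ^ CARD('n) \<le> p ^ CARD('m)"
  proof (cases Q)
    case (Suc k)
    then have "\<not> p ^ CARD('m) < (k + 1) ^ CARD('n)"
      unfolding Q_def by (intro not_less_Least) simp
    then show ?thesis using Suc by simp
  qed (simp add: zero_power)
  define A where "A = (UNIV :: 'n set) \<rightarrow>\<^sub>E {..Q}"
  define B where "B = (UNIV :: 'm set) \<rightarrow>\<^sub>E {..<p}"
  define vec where "vec f = (\<chi> j. real (f j))" for f :: "'n \<Rightarrow> nat"
  \<comment> \<open>\<open>g f\<close> is the index of the cell, of side \<open>1 / p\<close>, that contains the fractional part.\<close>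
  define g where "g f i = nat \<lfloor>p * frac ((\<Theta> *v vec f) $ i)\<rfloor>" for f and i :: 'm
  have "g f i < p" for f i
  proof -
    have "p * frac ((\<Theta> *v vec f) $ i) < p" using assms frac_lt_1 by simp
    then show ?thesis using assms unfolding g_def by (simp add: nat_less_iff floor_less_iff)
  qed
  then have "g ` A \<subseteq> B" by (auto simp: B_def)
  then have "card (g ` A) \<le> card B" by (intro card_mono) (auto simp: B_def intro!: finite_PiE)
  also have "\<dots> = p ^ CARD('m)" by (simp add: B_def card_funcsetE)
  also have "\<dots> < card A" using Q by (simp add: A_def card_funcsetE)
  finally have "\<not> inj_on g A" by (rule pigeonhole)
  then obtain f f' where f: "f \<in> A" "f' \<in> A" "g f = g f'" "f \<noteq> f'" by (auto simp: inj_on_def)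
  define y where "y = vec f - vec f'"
  have "y \<in> integer_vectors" by (simp add: y_def vec_def integer_vectors_def)
  moreover have "y \<noteq> 0" using f(4) by (auto simp: y_def vec_def vec_eq_iff)
  moreover have "\<bar>y $ j\<bar> \<le> real Q" for j
  proof -
    have "f j \<le> Q" "f' j \<le> Q" using f by (auto simp: A_def PiE_iff)
    then show ?thesis by (simp add: y_def vec_def)
  qed
  moreover have "approx_error \<Theta> y \<le> 1 / real p"
    unfolding approx_error_le_iff
  proof
    fix i
    define a where "a = (\<Theta> *v vec f) $ i"
    define b where "b = (\<Theta> *v vec f') $ i"
    have "nat \<lfloor>p * frac a\<rfloor> = nat \<lfloor>p * frac b\<rfloor>"
      using fun_cong[OF f(3), of i] by (simp add: g_def a_def b_def)
    then have "\<lfloor>p * frac a\<rfloor> = \<lfloor>p * frac b\<rfloor>" by (simp add: eq_nat_nat_iff frac_ge_0)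
    then have "\<bar>p * frac a - p * frac b\<bar> \<le> 1" by linarith
    then have "p * \<bar>frac a - frac b\<bar> \<le> 1" by (simp add: abs_mult flip: right_diff_distrib)
    then have *: "\<bar>frac a - frac b\<bar> \<le> 1 / p" using assms by (simp add: field_simps)
    have "dist_int ((\<Theta> *v y) $ i) \<le> \<bar>(\<Theta> *v y) $ i - of_int (\<lfloor>a\<rfloor> - \<lfloor>b\<rfloor>)\<bar>" by (rule dist_int_le)
    also have "\<dots> = \<bar>frac a - frac b\<bar>"
      by (simp add: y_def matrix_vector_mult_diff_distrib a_def b_def frac_def)
    finally show "dist_int ((\<Theta> *v y) $ i) \<le> 1 / real p" using * by simp
  qed
  ultimately show ?thesis using Q' by blast
qed

lemma transference_identity:
  "y \<bullet> \<eta> = (\<Sum>i\<in>UNIV. of_int (x $ i) * (\<Theta> *v y) $ i) + (\<Sum>j\<in>UNIV. y $ j * - (lin_form \<Theta> j x - \<eta> $ j))"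
proof -
  have "(\<Sum>j\<in>UNIV. y $ j * lin_form \<Theta> j x) = (\<Sum>j\<in>UNIV. \<Sum>i\<in>UNIV. y $ j * (\<Theta> $ i $ j * of_int (x $ i)))"
    by (simp add: lin_form_def sum_distrib_left)
  also have "\<dots> = (\<Sum>i\<in>UNIV. \<Sum>j\<in>UNIV. y $ j * (\<Theta> $ i $ j * of_int (x $ i)))" by (rule sum.swap)
  also have "\<dots> = (\<Sum>i\<in>UNIV. of_int (x $ i) * (\<Theta> *v y) $ i)"
    by (simp add: matrix_vector_mult_def sum_distrib_left algebra_simps)
  finally show ?thesis
    by (simp add: inner_vec_def sum.distrib right_diff_distrib sum_subtractf sum_negf)
qed

lemma dist_int_inner_le:
  fixes \<Theta> :: "real^'n^'m" and X Y e :: real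
  assumes y: "y \<in> integer_vectors" "\<And>j. \<bar>y $ j\<bar> \<le> Y"
    and x: "\<And>i. \<bar>real_of_int (x $ i)\<bar> \<le> X"
    and e: "\<And>j. dist_int (lin_form \<Theta> j x - \<eta> $ j) \<le> e"
  shows "dist_int (y \<bullet> \<eta>) \<le> CARD('m) * X * approx_error \<Theta> y + CARD('n) * Y * e"
proof -
  have 1: "dist_int (of_int (x $ i) * (\<Theta> *v y) $ i) \<le> X * approx_error \<Theta> y" for i
  proof -
    have "\<bar>real_of_int (x $ i)\<bar> * dist_int ((\<Theta> *v y) $ i) \<le> X * approx_error \<Theta> y"
      using x[of i] by (intro mult_mono dist_int_le_approx_error dist_int_nonneg) auto
    then show ?thesis using dist_int_int_mult order_trans by blast
  qed
  have 2: "dist_int (y $ j * - (lin_form \<Theta> j x - \<eta> $ j)) \<le> Y * e" for j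
  proof -
    obtain k where k: "y $ j = of_int k" using y(1) by (auto simp: integer_vectors_def elim: Ints_cases)
    have "dist_int (y $ j * - (lin_form \<Theta> j x - \<eta> $ j)) \<le> \<bar>y $ j\<bar> * dist_int (- (lin_form \<Theta> j x - \<eta> $ j))"
      unfolding k by (rule dist_int_int_mult)
    also have "\<dots> \<le> Y * e"
      unfolding dist_int_uminus using y(2)[of j] e[of j] by (intro mult_mono dist_int_nonneg) auto
    finally show ?thesis .
  qed
  have "dist_int (y \<bullet> \<eta>) \<le> (\<Sum>i\<in>UNIV. dist_int (of_int (x $ i) * (\<Theta> *v y) $ i))
      + (\<Sum>j\<in>UNIV. dist_int (y $ j * - (lin_form \<Theta> j x - \<eta> $ j)))"
    unfolding transference_identity[of y \<eta> x \<Theta>]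
    by (rule order_trans[OF dist_int_add add_mono[OF dist_int_sum dist_int_sum]])
  also have "\<dots> \<le> (\<Sum>i\<in>(UNIV::'m set). X * approx_error \<Theta> y) + (\<Sum>j\<in>(UNIV::'n set). Y * e)"
    by (intro add_mono sum_mono 1 2)
  finally show ?thesis by simp
qed

lemma bad_affineI:
  fixes \<Theta> :: "real^'n^'m"
  assumes \<delta>: "\<delta> > 0" "\<And>y. y \<in> best_approximations \<Theta> \<Longrightarrow> \<delta> \<le> dist_int (y \<bullet> \<eta>)"
  shows "\<eta> \<in> bad_affine \<Theta>"
proof -
  define n m where "n = real CARD('n)" and "m = real CARD('m)"
  define c where "c = (\<delta> / (2 * n * n)) ^ CARD('n) / (2 * m / \<delta> + 1) ^ CARD('m)"
  have nm: "n > 0" "m > 0" by (simp_all add: n_def m_def)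
  then have c: "c > 0" using \<delta>(1) by (simp add: c_def add_pos_pos)
  have "c \<le> (MAX j. dist_int (lin_form \<Theta> j x - \<eta> $ j)) ^ CARD('n) *
      (MAX i. \<bar>real_of_int (x $ i)\<bar>) ^ CARD('m)" if nz: "x \<noteq> 0" for x :: "int^'m"
  proof -
    define e where "e = (MAX j. dist_int (lin_form \<Theta> j x - \<eta> $ j))"
    define X where "X = (MAX i. \<bar>real_of_int (x $ i)\<bar>)"
    have e: "dist_int (lin_form \<Theta> j x - \<eta> $ j) \<le> e" for j unfolding e_def by (rule Max_ge) auto
    have xX: "\<bar>real_of_int (x $ i)\<bar> \<le> X" for i unfolding X_def by (rule Max_ge) auto
    have e0: "e \<ge> 0" using e dist_int_nonneg order_trans by blast
    obtain i where "x $ i \<noteq> 0" using nz by (auto simp: vec_eq_iff)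
    then have X1: "X \<ge> 1" using xX[of i] by linarith
    \<comment> \<open>The choice of \<open>p\<close> makes the contribution of \<open>\<Theta> *v z\<close> at most \<open>\<delta> / 2\<close>, with \<open>p\<close> at most a
      constant times \<open>X\<close>.\<close>
    define p where "p = nat \<lceil>2 * m * X / \<delta>\<rceil>"
    have "2 * m * X / \<delta> > 0" using nm X1 \<delta>(1) by simp
    then have p: "p \<ge> 1" "2 * m * X / \<delta> \<le> p" "p \<le> 2 * m * X / \<delta> + 1"
      unfolding p_def by linarith+
    obtain y Q where y: "y \<in> integer_vectors" "y \<noteq> 0" "Q ^ CARD('n) \<le> p ^ CARD('m)"
      "\<And>j. \<bar>y $ j\<bar> \<le> real Q" "approx_error \<Theta> y \<le> 1 / real p"
      using dirichlet_linear_forms[OF p(1), of \<Theta>] by blast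
    obtain z where z: "z \<in> best_approximations \<Theta>" "norm z \<le> norm y" "approx_error \<Theta> z \<le> approx_error \<Theta> y"
      using best_approximation_exists[OF y(1,2)] by blast
    have "norm z \<le> (\<Sum>j\<in>UNIV. \<bar>y $ j\<bar>)" using z(2) norm_le_l1_cart[of y] by simp
    also have "\<dots> \<le> (\<Sum>j\<in>(UNIV::'n set). real Q)" by (intro sum_mono y)
    finally have "\<bar>z $ j\<bar> \<le> n * Q" for j
      using component_le_norm_cart[of z j] by (simp add: n_def)
    then have "\<delta> \<le> m * X * approx_error \<Theta> z + n * (n * Q) * e"
      using \<delta>(2)[OF z(1)] z(1) dist_int_inner_le[OF _ _ xX e, of z "n * Q"]
      by (force simp: n_def m_def best_approximations_def)
    also have "m * X * approx_error \<Theta> z \<le> m * X * (1 / p)"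
      using z(3) y(5) nm X1 by (intro mult_left_mono) auto
    also have "\<dots> \<le> \<delta> / 2" using p(1,2) \<delta>(1) by (simp add: field_simps)
    finally have "\<delta> / (2 * n * n) \<le> Q * e" using nm by (simp add: field_simps)
    then have "(\<delta> / (2 * n * n)) ^ CARD('n) \<le> (Q * e) ^ CARD('n)"
      using \<delta>(1) nm by (intro power_mono) auto
    also have "\<dots> = real (Q ^ CARD('n)) * e ^ CARD('n)" by (simp add: power_mult_distrib)
    also have "\<dots> \<le> real (p ^ CARD('m)) * e ^ CARD('n)"
      using y(3) e0 by (intro mult_right_mono) (simp_all only: of_nat_le_iff zero_le_power)
    also have "real (p ^ CARD('m)) * e ^ CARD('n) \<le> ((2 * m / \<delta> + 1) * X) ^ CARD('m) * e ^ CARD('n)"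
    proof -
      have "real p \<le> (2 * m / \<delta> + 1) * X" using p(3) X1 by (simp add: algebra_simps)
      then show ?thesis unfolding of_nat_power using e0 by (intro mult_right_mono power_mono) auto
    qed
    also have "\<dots> = (2 * m / \<delta> + 1) ^ CARD('m) * (e ^ CARD('n) * X ^ CARD('m))"
      by (simp only: power_mult_distrib mult_ac)
    finally have "(\<delta> / (2 * n * n)) ^ CARD('n) \<le> (2 * m / \<delta> + 1) ^ CARD('m) * (e ^ CARD('n) * X ^ CARD('m))" .
    moreover have "(2 * m / \<delta> + 1) ^ CARD('m) > 0" using nm \<delta>(1) by (simp add: add_pos_pos)
    ultimately show ?thesis
      unfolding c_def e_def[symmetric] X_def[symmetric] by (simp add: pos_divide_le_eq mult.commute)
  qed
  moreover have "(1 :: int^'m) \<noteq> 0" by (simp add: vec_eq_iff)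
  then have "UNIV - {0 :: int^'m} \<noteq> {}" by blast
  ultimately have "c \<le> (INF x \<in> UNIV - {0 :: int^'m}. (MAX j. dist_int (lin_form \<Theta> j x - \<eta> $ j)) ^ CARD('n) *
      (MAX i. \<bar>real_of_int (x $ i)\<bar>) ^ CARD('m))"
    by (intro cINF_greatest) auto
  with c show ?thesis unfolding bad_affine_def by simp
qed

theorem theorem1:
  fixes \<Theta> :: "real^'n^'m" and \<alpha> :: real
  assumes "0 < \<alpha>" and "\<alpha> < 1/2"
  shows "alpha_winning \<alpha> (bad_affine \<Theta>)"
proof (rule alpha_winning_mono)
  show "alpha_winning \<alpha> {\<eta>. \<exists>\<delta>>0. \<forall>y\<in>best_approximations \<Theta>. \<delta> \<le> dist_int (y \<bullet> \<eta>)}"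
    using assms bounded_per_scale_best_approximations
    by (rule alpha_winning_of_bounded_per_scale)
      (auto simp: best_approximations_def norm_integer_vector_ge_1)
  show "{\<eta>. \<exists>\<delta>>0. \<forall>y\<in>best_approximations \<Theta>. \<delta> \<le> dist_int (y \<bullet> \<eta>)} \<subseteq> bad_affine \<Theta>"
    using bad_affineI by blast
qed

end
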